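(* The $q$-Chebyshev polynomials satisfy, for all integers $n\ge 0$, the recursion $$\begin{pmatrix} T_{n+1}(x,s,q)\\ U_n(x,s,q)\end{pmatrix}=\begin{pmatrix} q^nx & (x^2+qs)\eta^2\\ 1 & q^nx\end{pmatrix}\begin{pmatrix} T_n(x,s,q)\\ U_{n-1}(x,s,q)\end{pmatrix},$$ that is, $T_{n+1}(x,s,q)=q^nx\,T_n(x,s,q)+(x^2+qs)\,U_{n-1}(x,q^2s,q)$ and $U_n(x,s,q)=T_n(x,s,q)+q^nx\,U_{n-1}(x,s,q)$, with initial values $U_{-1}(x,s,q)=0$ and $T_0(x,s,q)=1$, and they are uniquely determined by this condition.
   Context: Here $x,s,q$ are indeterminates. Notation: $(a;q)_n=\prod_{j=0}^{n-1}(1-q^ja)$; $\begin{bmatrix} n\\k\end{bmatrix}=\frac{(q;q)_n}{(q;q)_k(q;q)_{n-k}}$ for $0\le k\le n$; $[n]=\frac{1-q^n}{1-q}$. The linear operator $\eta$ acts on polynomials in $x,s$ by $\eta f(x,s)=f(x,qs)$. The $q$-Chebyshev polynomials of the second kind are $U_{-1}(x,s,q)=0$ and, for $n\ge0$, $$U_n(x,s,q)=\sum_{k=0}^{\lfloor n/2\rfloor}q^{k^2}\begin{bmatrix} n-k\\k\end{bmatrix}(1+q^{k+1})\cdots(1+q^{n-k})\,s^kx^{n-2k}.$$ The $q$-Chebyshev polynomials of the first kind are $T_0(x,s,q)=1$ and, for $n>0$, $$T_n(x,s,q)=\sum_{k=0}^{\lfloor n/2\rfloor}q^{k^2}\frac{[n]}{[n-k]}\begin{bmatrix}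 n-k\\k\end{bmatrix}\frac{(-q;q)_{n-1}}{(-q;q)_k\,(-q^{n-k};q)_k}\,s^kx^{n-2k}.$$ *)

theory Defs
  imports
    "HOL-Computational_Algebra.Polynomial"
    "HOL-Computational_Algebra.Fraction_Field"
begin

text \<open>
  The coefficient field is \<open>k(q)\<close>, the type \<open>'a poly fract\<close>, where \<open>k\<close> is an arbitrary field \<open>'a\<close>.
  The $q$-notation below makes sense for an element \<open>q\<close> of any field; at \<open>q = q_indet\<close> none of the
  denominators that occur vanishes, in any characteristic.
\<close>

definition q_indet :: "'a::field poly fract" where
  "q_indet = Fract [:0, 1:] 1"

definition q_pochhammer :: "'a::field \<Rightarrow> 'a \<Rightarrow> nat \<Rightarrow> 'a" where
  "q_pochhammer a q n = (\<Prod>j<n. 1 - q ^ j * a)"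

text \<open>Used for \<open>k \<le> n\<close> only.\<close>

definition q_binomial :: "'a::field \<Rightarrow> nat \<Rightarrow> nat \<Rightarrow> 'a" where
  "q_binomial q n k =
     q_pochhammer q q n / (q_pochhammer q q k * q_pochhammer q q (n - k))"

definition q_number :: "'a::field \<Rightarrow> nat \<Rightarrow> 'a" where
  "q_number q n = (1 - q ^ n) / (1 - q)"

text \<open>
  The ring \<open>K[x,s]\<close> is the type \<open>'k poly poly\<close>, read as \<open>K[x][s]\<close>: the outer variable is \<open>s\<close>, the
  inner one is \<open>x\<close>.
\<close>

definition cnst :: "'k::field \<Rightarrow> 'k poly poly" where
  "cnst c = [:[:c:]:]"

definition var_x :: "'k::field poly poly" where
  "var_x = [:[:0, 1:]:]"

definition var_s :: "'k::field poly poly" where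
  "var_s = [:0, 1:]"

definition eta :: "'k::field \<Rightarrow> 'k poly poly \<Rightarrow> 'k poly poly" where
  "eta q f = pcompose f (cnst q * var_s)"

text \<open>The index is an integer so that \<open>U\<^sub>-\<^sub>1 = 0\<close> can be expressed; indices below \<open>-1\<close> are not used.\<close>

definition cheb_U :: "'k::field \<Rightarrow> int \<Rightarrow> 'k poly poly" where
  "cheb_U q m =
     (if m < 0 then 0
      else let n = nat m in
        \<Sum>k = 0..n div 2.
          cnst (q ^ k\<^sup>2 * q_binomial q (n - k) k * (\<Prod>j = k + 1..n - k. 1 + q ^ j))
            * var_s ^ k * var_x ^ (n - 2 * k))"

definition cheb_T :: "'k::field \<Rightarrow> nat \<Rightarrow> 'k poly poly" where
  "cheb_T q n =
     (if n = 0 then 1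
      else \<Sum>k = 0..n div 2.
          cnst (q ^ k\<^sup>2 * (q_number q n / q_number q (n - k)) * q_binomial q (n - k) k
                * (q_pochhammer (- q) q (n - 1)
                   / (q_pochhammer (- q) q k * q_pochhammer (- (q ^ (n - k))) q k)))
            * var_s ^ k * var_x ^ (n - 2 * k))"

end

theory Submission imports Defs begin

text \<open>
  The defining coefficients of \<open>U\<^sub>n\<close> and \<open>T\<^sub>n\<close> become much simpler in terms of the two
  Pochhammer symbols \<open>R m = (q;q)\<^sub>m\<close> and \<open>Q m = (q\<^sup>2;q\<^sup>2)\<^sub>m = R m (-q;q)\<^sub>m\<close>: the products of
  factors \<open>1 + q^j\<close> combine with the q-binomial coefficient, and the coefficients of
  \<open>s^k x^(n-2k)\<close> are
    \<open>u(n,k) = q^(k\<^sup>2) Q(n-k) / (Q(k) R(n-2k))\<close> and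
    \<open>t(n,k) = q^(k\<^sup>2) (1 - q^n) Q(n-k-1) / (Q(k) R(n-2k))\<close>
  (lemmas \<open>cheb_U_coefficient\<close> and \<open>cheb_T_coefficient\<close>).

  Since \<open>\<eta>\<^sup>2\<close> multiplies the coefficient of \<open>s^k\<close> by \<open>q^(2k)\<close>, comparing coefficients of \<open>s^k\<close>
  turns the matrix recursion into the two scalar recursions
    \<open>u(n,k) = t(n,k) + q^n u(n-1,k)\<close> and
    \<open>t(n+1,k) = q^n t(n,k) + q^(2k) u(n-1,k) + q^(2k-1) u(n-1,k-1)\<close>.
  Away from the boundary \<open>n \<approx> 2k\<close> all terms share a common factor. After removing it, the first
  recursion is \<open>1 - q^(2(n-k)) = (1 - q^n) + q^n (1 - q^(n-2k))\<close>, and the second is the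
  polynomial identity inside \<open>T_coeff_identity\<close>. The boundary cases, in which
  some of the coefficients vanish because \<open>2k\<close> exceeds the index, are checked directly.

  The only property of \<open>q\<close> that enters is that it is not a root of unity, so that \<open>Q\<close> and \<open>R\<close> are
  invertible; an indeterminate has this property. Uniqueness is immediate, because the recursion
  computes the pair with index \<open>n + 1\<close> from the pair with index \<open>n\<close>.
\<close>

section \<open>q-Pochhammer symbols\<close>

lemma q_pochhammer_0 [simp]: "q_pochhammer a q 0 = 1"
  by (simp add: q_pochhammer_def)

lemma q_pochhammer_Suc: "q_pochhammer a q (Suc n) = q_pochhammer a q n * (1 - q ^ n * a)"
  by (simp add: q_pochhammer_def)

lemma q_pochhammer_add:
  "q_pochhammer a q (m + n) = q_pochhammer a q m * q_pochhammer (q ^ m * a) q n"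
  by (induction n) (simp_all add: q_pochhammer_Suc power_add mult_ac)

text \<open>
  The factorization \<open>1 - q^(2j) = (1 - q^j) (1 + q^j)\<close>, taken factor by factor; it lets the products
  of \<open>1 + q^j\<close> in the Chebyshev coefficients combine with \<open>(q;q)\<close> symbols into symbols in base \<open>q\<^sup>2\<close>.
\<close>

lemma q_pochhammer_square:
  "q_pochhammer (q\<^sup>2) (q\<^sup>2) n = q_pochhammer q q n * q_pochhammer (- q) q n"
proof (induction n)
  case (Suc n)
  have "1 - (q\<^sup>2) ^ n * q\<^sup>2 = (1 - q ^ n * q) * (1 - q ^ n * - q)"
    by (simp add: algebra_simps power2_eq_square power_mult_distrib)
  with Suc show ?case
    by (simp add: q_pochhammer_Suc mult_ac)
qed simp

lemma q_pochhammer_square_Suc: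
  "q_pochhammer (q\<^sup>2) (q\<^sup>2) (Suc n) = q_pochhammer (q\<^sup>2) (q\<^sup>2) n * (1 - q ^ (2 * n + 2))"
  by (simp add: q_pochhammer_Suc power_mult [symmetric] flip: power_add)

lemma prod_eq_q_pochhammer: "(\<Prod>j = k + 1..k + m. 1 + q ^ j) = q_pochhammer (- (q ^ (k + 1))) q m"
  by (induction m) (simp_all add: q_pochhammer_Suc power_add mult_ac)

text \<open>
  Each \<open>1 + q^j\<close> is a factor of \<open>1 - q^(2j)\<close>, so it is nonzero in every characteristic.
\<close>

lemma q_pochhammer_nonzero:
  assumes "\<And>j. j > 0 \<Longrightarrow> q ^ j \<noteq> (1::'k::field)"
  shows "q_pochhammer q q n \<noteq> 0"
    and "q_pochhammer (q\<^sup>2) (q\<^sup>2) n \<noteq> 0"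
    and "q_pochhammer (- q) q n \<noteq> 0"
proof -
  have "1 - q ^ j * q \<noteq> 0" for j
    using assms[of "Suc j"] by (simp add: mult.commute)
  then show R: "q_pochhammer q q n \<noteq> 0"
    by (simp add: q_pochhammer_def)
  have "1 - q ^ (2 * j + 2) \<noteq> 0" for j
    using assms[of "2 * j + 2"] by simp
  then have "q_pochhammer (q\<^sup>2) (q\<^sup>2) n \<noteq> 0" for n
    by (induction n) (simp_all only: q_pochhammer_0 q_pochhammer_square_Suc mult_eq_0_iff, simp_all)
  then show "q_pochhammer (q\<^sup>2) (q\<^sup>2) n \<noteq> 0" .
  then show "q_pochhammer (- q) q n \<noteq> 0"
    by (auto simp: q_pochhammer_square)
qed

section \<open>Closed forms of the coefficients\<close>

text \<open>
  With the value zero for \<open>2 * k > n\<close>, the recursions below hold without a bound on \<open>k\<close>.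
\<close>

definition U_coeff :: "'k::field \<Rightarrow> nat \<Rightarrow> nat \<Rightarrow> 'k" where
  "U_coeff q n k =
     (if 2 * k \<le> n
      then q ^ k\<^sup>2 * q_pochhammer (q\<^sup>2) (q\<^sup>2) (n - k)
             / (q_pochhammer (q\<^sup>2) (q\<^sup>2) k * q_pochhammer q q (n - 2 * k))
      else 0)"

text \<open>
  The case \<open>n = 0\<close> is separate because the factor \<open>1 - q ^ n\<close> would give \<open>0\<close> instead of \<open>T\<^sub>0 = 1\<close>.
\<close>

definition T_coeff :: "'k::field \<Rightarrow> nat \<Rightarrow> nat \<Rightarrow> 'k" where
  "T_coeff q n k =
     (if n = 0 then (if k = 0 then 1 else 0)
      else if 2 * k \<le> n
      then q ^ k\<^sup>2 * (1 - q ^ n) * q_pochhammer (q\<^sup>2) (q\<^sup>2) (n - k - 1)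
             / (q_pochhammer (q\<^sup>2) (q\<^sup>2) k * q_pochhammer q q (n - 2 * k))
      else 0)"

text \<open>
  With \<open>n = 2k + m\<close>, the product \<open>(1 + q^(k+1)) \<dots> (1 + q^(k+m))\<close> is \<open>(-q;q)\<^sub>k\<^sub>+\<^sub>m / (-q;q)\<^sub>k\<close>; together
  with \<open>(q;q)\<^sub>k\<^sub>+\<^sub>m / (q;q)\<^sub>k\<close> from the q-binomial coefficient it gives a quotient of symbols in
  base \<open>q\<^sup>2\<close>.
\<close>

lemma cheb_U_coefficient:
  assumes "\<And>j. j > 0 \<Longrightarrow> q ^ j \<noteq> (1::'k::field)" and "2 * k \<le> n"
  shows "q ^ k\<^sup>2 * q_binomial q (n - k) k * (\<Prod>j = k + 1..n - k. 1 + q ^ j) = U_coeff q n k"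
proof -
  obtain m where n: "n = 2 * k + m"
    using assms(2) le_Suc_ex by blast
  have idx: "n - k = k + m" "n - 2 * k = m" "k + m - k = m"
    using n by simp_all
  have "q_pochhammer (- q) q (k + m) = q_pochhammer (- q) q k * q_pochhammer (- (q ^ (k + 1))) q m"
    by (simp add: q_pochhammer_add mult.commute)
  with assms(2) q_pochhammer_nonzero[OF assms(1)] show ?thesis
    unfolding U_coeff_def q_binomial_def idx prod_eq_q_pochhammer q_pochhammer_square
    by (simp add: field_simps)
qed

text \<open>
  Here \<open>(-q;q)\<^sub>n\<^sub>-\<^sub>1 / (-q^(n-k);q)\<^sub>k = (-q;q)\<^sub>n\<^sub>-\<^sub>k\<^sub>-\<^sub>1\<close>, and dividing the q-binomial coefficient by
  \<open>[n-k]\<close> lowers \<open>(q;q)\<^sub>n\<^sub>-\<^sub>k\<close> to \<open>(q;q)\<^sub>n\<^sub>-\<^sub>k\<^sub>-\<^sub>1\<close>. This form also covers \<open>2 * k = n\<close>, where the quotient of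
  the \<open>(-q;q)\<close> symbols is not a product of factors \<open>1 + q^j\<close> but \<open>1 / (1 + q^k)\<close>.
\<close>

lemma cheb_T_coefficient:
  assumes "\<And>j. j > 0 \<Longrightarrow> q ^ j \<noteq> (1::'k::field)" and "2 * k \<le> n" and "n > 0"
  shows "q ^ k\<^sup>2 * (q_number q n / q_number q (n - k)) * q_binomial q (n - k) k
           * (q_pochhammer (- q) q (n - 1)
               / (q_pochhammer (- q) q k * q_pochhammer (- (q ^ (n - k))) q k))
         = T_coeff q n k"
proof -
  define l where "l = n - k - 1"
  have idx: "n - k = Suc l" "n - 1 = l + k" "Suc l - k = n - 2 * k"
    using assms(2,3) by (auto simp: l_def)
  have *: "q_pochhammer (- q) q (l + k) = q_pochhammer (- q) q l * q_pochhammer (- (q ^ Suc l)) q k"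
    by (simp add: q_pochhammer_add mult.commute)
  have "q_pochhammer (- q) q (l + k) \<noteq> 0"
    by (rule q_pochhammer_nonzero[OF assms(1)])
  then have nz: "q_pochhammer (- (q ^ Suc l)) q k \<noteq> 0"
    unfolding * by simp
  have nz': "1 - q ^ Suc l \<noteq> 0" "1 - q \<noteq> 0"
    using assms(1)[of "Suc l"] assms(1)[of 1] by auto
  have R: "q_pochhammer q q (Suc l) = q_pochhammer q q l * (1 - q ^ Suc l)"
    by (simp add: q_pochhammer_Suc mult.commute)
  have "T_coeff q n k = q ^ k\<^sup>2 * (1 - q ^ n) * q_pochhammer (q\<^sup>2) (q\<^sup>2) l
             / (q_pochhammer (q\<^sup>2) (q\<^sup>2) k * q_pochhammer q q (n - 2 * k))"
    using assms(2,3) by (simp add: T_coeff_def l_def)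
  with nz nz' q_pochhammer_nonzero[OF assms(1)] show ?thesis
    unfolding q_binomial_def q_number_def idx * q_pochhammer_square R
    by (simp add: divide_simps mult_ac del: power_Suc)
qed

lemma coeff_sum_cnst_var_s_var_x:
  "poly.coeff (\<Sum>k = 0..n div 2. cnst (c k) * var_s ^ k * var_x ^ (n - 2 * k)) i
     = (if 2 * i \<le> n then monom (c i) (n - 2 * i) else 0)"
proof -
  have "cnst (c k) * var_s ^ k * var_x ^ (n - 2 * k) = monom (monom (c k) (n - 2 * k)) k" for k
  proof -
    have "(var_x :: 'a poly poly) ^ m = [:monom 1 m:]" for m
      by (induction m) (simp_all add: var_x_def monom_Suc one_pCons mult.commute)
    moreover have "(var_s :: 'a poly poly) ^ k = monom 1 k"
      by (induction k) (simp_all add: var_s_def monom_Suc flip: one_pCons)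
    ultimately show ?thesis
      by (simp add: cnst_def smult_monom mult.commute)
  qed
  then show ?thesis
    by (auto simp: coeff_sum sum.delta)
qed

text \<open>
  The exponent \<open>n - 2 * k\<close> is truncated at \<open>0\<close> for \<open>2 * k > n\<close>, which is harmless because the
  coefficient is then \<open>0\<close>. The same holds for \<open>coeff_cheb_T\<close>.
\<close>

lemma coeff_cheb_U:
  assumes "\<And>j. j > 0 \<Longrightarrow> q ^ j \<noteq> (1::'k::field)"
  shows "poly.coeff (cheb_U q (int n)) k = monom (U_coeff q n k) (n - 2 * k)"
  using cheb_U_coefficient[OF assms, of k n]
  by (auto simp: cheb_U_def coeff_sum_cnst_var_s_var_x U_coeff_def simp del: One_nat_def)

lemma coeff_cheb_T:
  assumes "\<And>j. j > 0 \<Longrightarrow> q ^ j \<noteq> (1::'k::field)"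
  shows "poly.coeff (cheb_T q n) k = monom (T_coeff q n k) (n - 2 * k)"
proof (cases "n = 0")
  case True
  then show ?thesis
    by (auto simp: cheb_T_def T_coeff_def monom_0 one_pCons[symmetric])
next
  case False
  then show ?thesis
    using cheb_T_coefficient[OF assms, of k n]
    by (auto simp: cheb_T_def coeff_sum_cnst_var_s_var_x simp del: One_nat_def)
      (simp add: T_coeff_def)
qed

section \<open>Recursions for the coefficients\<close>

text \<open>
  For \<open>n = 2k + m\<close>, cancelling \<open>q^(k\<^sup>2) Q(k+m) / (Q(k) R(m+1))\<close> leaves
  \<open>1 - q^(2(k+m+1)) = (1 - q^(n+1)) + q^(n+1) (1 - q^(m+1))\<close>. For \<open>n + 1 = 2k\<close> the last term
  vanishes and both remaining coefficients are \<open>q^(k\<^sup>2)\<close>.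
\<close>

lemma U_coeff_Suc:
  assumes "\<And>j. j > 0 \<Longrightarrow> q ^ j \<noteq> (1::'k::field)"
  shows "U_coeff q (Suc n) k = T_coeff q (Suc n) k + q ^ Suc n * U_coeff q n k"
proof -
  consider "2 * k > Suc n" | "2 * k = Suc n" | m where "n = 2 * k + m"
    by (metis Suc_lessI le_Suc_ex not_le)
  then show ?thesis
  proof cases
    case 2
    then obtain l where "k = Suc l" "n = Suc (2 * l)"
      by (cases k) auto
    then show ?thesis
      by (simp add: U_coeff_def T_coeff_def q_pochhammer_Suc power_mult power_add
          power2_eq_square field_simps)
  next
    case 3
    define c d where "c = q ^ Suc n" and "d = q ^ Suc m"
    have idx: "Suc n - k = Suc (k + m)" "Suc n - k - 1 = k + m" "n - k = k + m"
        "n - 2 * k = m" "Suc n - 2 * k = Suc m" "2 * k \<le> n" "2 * k \<le> Suc n" "Suc n \<noteq> 0"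
      using 3 by simp_all
    have 1: "1 - q ^ (2 * (k + m) + 2) = (1 - c) + c * (1 - d)"
      by (simp add: c_def d_def 3 algebra_simps flip: power_add power_Suc)
    have 2: "q_pochhammer q q (Suc m) = q_pochhammer q q m * (1 - d)"
      by (simp add: q_pochhammer_Suc d_def mult.commute)
    have "1 - d \<noteq> 0"
      using assms[of "Suc m"] by (simp add: d_def)
    moreover have "w * (A * ((1 - c) + c * e)) / (B * (R * e))
        = w * (1 - c) * A / (B * (R * e)) + c * (w * A / (B * R))" if "e \<noteq> 0" for w A B R e
      using that by (simp add: distrib_left add_divide_distrib mult_ac)
    ultimately show ?thesis
      unfolding U_coeff_def T_coeff_def c_def[symmetric]
      by (simp only: idx q_pochhammer_square_Suc 1 2 if_True if_False not_False_eq_True diff_Suc_1)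
  qed (simp add: U_coeff_def T_coeff_def)
qed

text \<open>
  The case \<open>k = 0\<close> of the recursion for the \<open>T\<close>-coefficients, in which the term with \<open>k - 1\<close> is absent.
  With \<open>c = q^(n+1)\<close>, the common factor \<open>Q(n) / R(n)\<close> leaves \<open>1 + c = c + 1\<close>.
\<close>

lemma T_coeff_Suc_Suc_0:
  assumes "\<And>j. j > 0 \<Longrightarrow> q ^ j \<noteq> (1::'k::field)"
  shows "T_coeff q (Suc (Suc n)) 0 = q ^ Suc n * T_coeff q (Suc n) 0 + U_coeff q n 0"
proof -
  define c where "c = q ^ Suc n"
  have nz: "1 - c \<noteq> 0" "1 - q * c \<noteq> 0"
    using assms[of "Suc n"] assms[of "Suc (Suc n)"] by (auto simp: c_def)
  have "1 - q ^ (2 * n + 2) = (1 - c) * (1 + c)"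
    by (simp add: c_def algebra_simps flip: power_add power_Suc) (simp add: mult_2_right)
  then have Q: "q_pochhammer (q\<^sup>2) (q\<^sup>2) (Suc n) = q_pochhammer (q\<^sup>2) (q\<^sup>2) n * ((1 - c) * (1 + c))"
    by (simp only: q_pochhammer_square_Suc)
  have R: "q_pochhammer q q (Suc n) = q_pochhammer q q n * (1 - c)"
      "q_pochhammer q q (Suc (Suc n)) = q_pochhammer q q n * (1 - c) * (1 - q * c)"
    by (simp_all add: q_pochhammer_Suc c_def mult_ac)
  have cq: "q ^ Suc (Suc n) = q * c"
    by (simp add: c_def)
  have "T_coeff q (Suc (Suc n)) 0 = q_pochhammer (q\<^sup>2) (q\<^sup>2) n * (1 + c) / q_pochhammer q q n"
    using nz by (simp add: T_coeff_def Q R cq del: power_Suc)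
  moreover have "T_coeff q (Suc n) 0 = q_pochhammer (q\<^sup>2) (q\<^sup>2) n / q_pochhammer q q n"
    using nz by (simp add: T_coeff_def R del: power_Suc flip: c_def)
  moreover have "U_coeff q n 0 = q_pochhammer (q\<^sup>2) (q\<^sup>2) n / q_pochhammer q q n"
    by (simp add: U_coeff_def)
  ultimately show ?thesis
    by (simp add: distrib_left distrib_right mult.commute add_divide_distrib del: power_Suc flip: c_def)
qed

text \<open>
  The generic case of \<open>T_coeff_Suc_Suc_Suc\<close> for \<open>n = 2k + 2 + m\<close>, with \<open>a = q^(2k+2)\<close>, \<open>b = q^m\<close>,
  \<open>A = Q(k)\<close>, \<open>P = Q(k+m+1)\<close> and \<open>R = R(m)\<close>, so that for instance \<open>A (1 - a)\<close> is \<open>Q(k+1)\<close> and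
  \<open>P (1 - a b\<^sup>2 q\<^sup>2)\<close> is \<open>Q(k+m+2)\<close>. Taking out the factor \<open>C\<close> of the left-hand side leaves an identity
  between polynomials in \<open>a\<close>, \<open>b\<close> and \<open>q\<close>.
\<close>

lemma T_coeff_identity:
  fixes a b q A P R :: "'k::field"
  assumes "1 - a \<noteq> 0" "1 - b * q \<noteq> 0" "1 - b * q\<^sup>2 \<noteq> 0"
  shows "(1 - a * b * q\<^sup>2) * (P * (1 - a * b\<^sup>2 * q\<^sup>2)) / (A * (1 - a) * (R * (1 - b * q) * (1 - b * q\<^sup>2)))
        = a * b * q * ((1 - a * b * q) * P / (A * (1 - a) * (R * (1 - b * q))))
          + a * (P / (A * (1 - a) * R))
          + P * (1 - a * b\<^sup>2 * q\<^sup>2) / (A * (R * (1 - b * q) * (1 - b * q\<^sup>2)))"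
proof -
  define t v w where "t = 1 - a" and "v = 1 - b * q" and "w = 1 - b * q\<^sup>2"
  define C where "C = P / (A * t * (R * v * w))"
  have nz: "t \<noteq> 0" "v \<noteq> 0" "w \<noteq> 0"
    using assms by (simp_all add: t_def v_def w_def)
  have P1: "P / (A * t * (R * v)) = C * w" and P2: "P / (A * t * R) = C * v * w"
      and P3: "P / (A * (R * v * w)) = C * t"
    using nz by (simp_all add: C_def)
  have E: "(1 - a * b * q\<^sup>2) * (1 - a * b\<^sup>2 * q\<^sup>2)
      = a * b * q * (1 - a * b * q) * w + a * v * w + t * (1 - a * b\<^sup>2 * q\<^sup>2)"
    unfolding t_def v_def w_def by algebra
  have "(1 - a * b * q\<^sup>2) * (P * (1 - a * b\<^sup>2 * q\<^sup>2)) / (A * t * (R * v * w))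
      = C * ((1 - a * b * q\<^sup>2) * (1 - a * b\<^sup>2 * q\<^sup>2))"
    by (simp add: C_def)
  also have "\<dots> = a * b * q * ((1 - a * b * q) * (C * w)) + a * (C * v * w) + (1 - a * b\<^sup>2 * q\<^sup>2) * (C * t)"
    unfolding E by (simp only: distrib_left mult_ac)
  finally show ?thesis
    unfolding P1[symmetric] P2[symmetric] P3[symmetric]
    unfolding t_def v_def w_def by (simp add: mult_ac)
qed

text \<open>
  The coefficients on the right vanish successively as \<open>n\<close> decreases to \<open>2k\<close>: for \<open>n = 2k + 1\<close>
  the coefficient \<open>u(n,k+1)\<close> is zero, and for \<open>n = 2k\<close> only \<open>u(n,k)\<close> survives.
\<close>

lemma T_coeff_Suc_Suc_Suc:
  assumes "\<And>j. j > 0 \<Longrightarrow> q ^ j \<noteq> (1::'k::field)"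
  shows "T_coeff q (Suc (Suc n)) (Suc k)
           = q ^ Suc n * T_coeff q (Suc n) (Suc k) + q ^ (2 * Suc k) * U_coeff q n (Suc k)
             + q ^ (2 * k + 1) * U_coeff q n k"
proof -
  have sq: "q ^ (Suc k)\<^sup>2 = q ^ k\<^sup>2 * q ^ (2 * k + 1)"
    by (simp add: power_add [symmetric] power2_eq_square del: power_Suc)
      (simp add: algebra_simps mult_2_right)
  have nzk: "1 - q ^ (2 * k + 2) \<noteq> 0" "1 - q \<noteq> 0"
    using assms[of "2 * k + 2"] assms[of 1] by simp_all
  note nz = q_pochhammer_nonzero[OF assms]
  consider "2 * k > n" | "n = 2 * k" | "n = 2 * k + 1" | m where "n = 2 * k + 2 + m"
  proof -
    have "2 * k > n \<or> n = 2 * k \<or> n = 2 * k + 1 \<or> n = 2 * k + 2 + (n - 2 * k - 2)"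
      by linarith
    with that show thesis
      by blast
  qed
  then show ?thesis
  proof cases
    case 2
    then show ?thesis
      using nz nzk by (simp add: T_coeff_def U_coeff_def sq q_pochhammer_square_Suc)
  next
    case 3
    have 1: "T_coeff q (Suc (Suc n)) (Suc k) = q ^ (Suc k)\<^sup>2 * (1 - q ^ (2 * k + 2) * q) / (1 - q)"
      using 3 nz by (simp add: T_coeff_def q_pochhammer_Suc[of q q] mult.commute)
    have 2: "T_coeff q (Suc n) (Suc k) = q ^ (Suc k)\<^sup>2"
      using 3 nz nzk by (simp add: T_coeff_def q_pochhammer_square_Suc)
    have 4: "U_coeff q n (Suc k) = 0"
      using 3 by (simp add: U_coeff_def)
    have 5: "U_coeff q n k = q ^ k\<^sup>2 * (1 - q ^ (2 * k + 2)) / (1 - q)"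
      using 3 nz by (simp add: U_coeff_def q_pochhammer_Suc[of q q] q_pochhammer_square_Suc)
    have 6: "q ^ Suc n = q ^ (2 * k + 2)"
      using 3 by simp
    define e where "e = q ^ (2 * k + 2)"
    have 7: "q ^ (2 * Suc k) = e" "q ^ (2 * k + 1) * q = e"
      by (simp_all add: e_def)
    have "w * q' * (1 - e * q) / (1 - q) = e * (w * q') + q' * (w * (1 - e) / (1 - q))"
      if "q' * q = e" for w q'
    proof -
      have "w * q' * (1 - e * q) = e * (w * q') * (1 - q) + q' * (w * (1 - e))"
        by (simp add: algebra_simps)
      with nzk(2) show ?thesis
        by (simp add: divide_simps)
    qed
    from this[OF 7(2)] show ?thesis
      unfolding 1 2 4 5 6 7(1) sq e_def[symmetric] by simp
  next
    case 4
    define a b where "a = q ^ (2 * k + 2)" and "b = q ^ m"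
    define A P R where "A = q_pochhammer (q\<^sup>2) (q\<^sup>2) k"
      and "P = q_pochhammer (q\<^sup>2) (q\<^sup>2) (k + m + 1)" and "R = q_pochhammer q q m"
    have A': "q_pochhammer (q\<^sup>2) (q\<^sup>2) (Suc k) = A * (1 - a)"
      by (simp only: q_pochhammer_square_Suc A_def a_def)
    have P': "q_pochhammer (q\<^sup>2) (q\<^sup>2) (k + m + 2) = P * (1 - a * b\<^sup>2 * q\<^sup>2)"
      using q_pochhammer_square_Suc[of q "k + m + 1"]
      by (simp add: P_def a_def b_def flip: power_add power_mult) (simp add: algebra_simps)
    have R': "q_pochhammer q q (m + 1) = R * (1 - b * q)"
      "q_pochhammer q q (m + 2) = R * (1 - b * q) * (1 - b * q\<^sup>2)"
      by (simp_all add: q_pochhammer_Suc R_def b_def power2_eq_square mult_ac)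
    have "1 - a \<noteq> 0"
      using nzk by (simp add: a_def)
    have "1 - b * q \<noteq> 0" "1 - b * q\<^sup>2 \<noteq> 0"
      using assms[of "m + 1"] assms[of "m + 2"]
      by (simp_all add: b_def power_add mult.commute power2_eq_square mult.assoc)
    have 1: "T_coeff q (Suc (Suc n)) (Suc k) = q ^ (Suc k)\<^sup>2
        * ((1 - a * b * q\<^sup>2) * (P * (1 - a * b\<^sup>2 * q\<^sup>2)) / (A * (1 - a) * (R * (1 - b * q) * (1 - b * q\<^sup>2))))"
    proof -
      have "Suc (Suc n) - Suc k - 1 = k + m + 2" "Suc (Suc n) - 2 * Suc k = m + 2"
          "q ^ Suc (Suc n) = a * b * q\<^sup>2" "2 * Suc k \<le> Suc (Suc n)"
        using 4 by (auto simp: a_def b_def simp flip: power_add power_Suc)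
      then show ?thesis
        unfolding T_coeff_def by (simp only: A' P' R') simp
    qed
    have 2: "T_coeff q (Suc n) (Suc k) = q ^ (Suc k)\<^sup>2
        * ((1 - a * b * q) * P / (A * (1 - a) * (R * (1 - b * q))))"
    proof -
      have "Suc n - Suc k - 1 = k + m + 1" "Suc n - 2 * Suc k = m + 1"
          "q ^ Suc n = a * b * q" "2 * Suc k \<le> Suc n"
        using 4 by (auto simp: a_def b_def power_add mult_ac)
      then show ?thesis
        unfolding T_coeff_def by (simp only: A' P_def[symmetric] R') simp
    qed
    have 3: "U_coeff q n (Suc k) = q ^ (Suc k)\<^sup>2 * (P / (A * (1 - a) * R))"
    proof -
      have "n - Suc k = k + m + 1" "n - 2 * Suc k = m" "2 * Suc k \<le> n"
        using 4 by auto
      then show ?thesis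
        unfolding U_coeff_def by (simp only: A' P_def[symmetric] R_def[symmetric]) simp
    qed
    have 5: "U_coeff q n k = q ^ k\<^sup>2
        * (P * (1 - a * b\<^sup>2 * q\<^sup>2) / (A * (R * (1 - b * q) * (1 - b * q\<^sup>2))))"
    proof -
      have "n - k = k + m + 2" "n - 2 * k = m + 2" "2 * k \<le> n"
        using 4 by auto
      then show ?thesis
        unfolding U_coeff_def by (simp only: A_def[symmetric] P' R') simp
    qed
    have 6: "q ^ Suc n = a * b * q" "q ^ (2 * Suc k) = a"
      using 4 by (simp_all add: a_def b_def power_add mult_ac)
    have "(1 - a * b * q\<^sup>2) * (P * (1 - a * b\<^sup>2 * q\<^sup>2)) / (A * (1 - a) * (R * (1 - b * q) * (1 - b * q\<^sup>2)))
        = a * b * q * ((1 - a * b * q) * P / (A * (1 - a) * (R * (1 - b * q))))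
          + a * (P / (A * (1 - a) * R))
          + P * (1 - a * b\<^sup>2 * q\<^sup>2) / (A * (R * (1 - b * q) * (1 - b * q\<^sup>2)))"
      using \<open>1 - a \<noteq> 0\<close> \<open>1 - b * q \<noteq> 0\<close> \<open>1 - b * q\<^sup>2 \<noteq> 0\<close> by (rule T_coeff_identity)
    then show ?thesis
      unfolding 1 2 3 5 6 sq by (simp only: distrib_left mult_ac)
  qed (simp add: U_coeff_def T_coeff_def)
qed

section \<open>Recursions for the polynomials\<close>

lemma coeff_cnst_mult: "poly.coeff (cnst c * p) k = smult c (poly.coeff p k)"
  by (simp add: cnst_def)

lemma coeff_var_x_mult: "poly.coeff (var_x * p) k = monom 1 1 * poly.coeff p k"
  by (simp add: var_x_def monom_altdef)

lemma coeff_var_s_mult: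
  "poly.coeff (var_s * p) k = (case k of 0 \<Rightarrow> 0 | Suc j \<Rightarrow> poly.coeff p j)"
  by (simp add: var_s_def coeff_pCons)

lemma coeff_eta: "poly.coeff (eta q p) k = smult (q ^ k) (poly.coeff p k)"
proof -
  have "cnst q * var_s = [:0, [:q:]:]"
    by (simp add: cnst_def var_s_def)
  moreover have "[:q:] ^ k = [:q ^ k:]"
    by (induction k) (simp_all add: one_pCons)
  ultimately show ?thesis
    by (simp add: eta_def coeff_pcompose_linear)
qed

text \<open>
  Comparison of the coefficients of \<open>s^k\<close>. With \<open>n = m + 1\<close>, multiplication by \<open>x\<close> raises
  \<open>x^(m-2k)\<close> to \<open>x^(m+1-2k)\<close> only if \<open>2 * k \<le> m\<close>, because the exponent is a truncated difference; otherwise the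
  coefficient itself vanishes. For \<open>n = 0\<close> the polynomial \<open>U\<^sub>-\<^sub>1 = 0\<close> is outside the coefficient
  formula.
\<close>

lemma cheb_U_rec:
  assumes "\<And>j. j > 0 \<Longrightarrow> q ^ j \<noteq> (1::'k::field)"
  shows "cheb_U q (int n) = cheb_T q n + cnst (q ^ n) * var_x * cheb_U q (int n - 1)"
proof (cases n)
  case 0
  then show ?thesis
    by (simp add: cheb_U_def cheb_T_def q_binomial_def cnst_def one_pCons)
next
  case (Suc m)
  have "poly.coeff (cheb_U q (int (Suc m))) k
          = poly.coeff (cheb_T q (Suc m) + cnst (q ^ Suc m) * var_x * cheb_U q (int m)) k" for k
  proof (cases "2 * k \<le> m")
    case True
    then show ?thesis
      by (simp add: coeff_cheb_U[OF assms] coeff_cheb_T[OF assms] U_coeff_Suc[OF assms]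
          coeff_cnst_mult coeff_var_x_mult mult.assoc smult_monom mult_monom add_monom
          Suc_diff_le
          del: of_nat_Suc power_Suc)
  next
    case False
    then have "U_coeff q m k = 0"
      by (simp add: U_coeff_def)
    then show ?thesis
      by (simp add: coeff_cheb_U[OF assms] coeff_cheb_T[OF assms] U_coeff_Suc[OF assms]
          coeff_cnst_mult coeff_var_x_mult mult.assoc del: of_nat_Suc)
  qed
  then show ?thesis
    using Suc by (simp add: poly_eq_iff)
qed

text \<open>
  The term \<open>x\<^sup>2 \<eta>\<^sup>2 U\<close> contributes \<open>q^(2k) u(n-1,k)\<close> to the coefficient of \<open>s^k\<close>, and \<open>q s \<eta>\<^sup>2 U\<close>
  contributes \<open>q \<cdot> q^(2(k-1)) u(n-1,k-1)\<close>, where both applications of \<open>\<eta>\<close> act before the shift by \<open>s\<close>.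
\<close>

lemma cheb_T_rec:
  assumes "\<And>j. j > 0 \<Longrightarrow> q ^ j \<noteq> (1::'k::field)"
  shows "cheb_T q (n + 1) = cnst (q ^ n) * var_x * cheb_T q n
           + (var_x\<^sup>2 + cnst q * var_s) * (eta q ^^ 2) (cheb_U q (int n - 1))"
proof (cases n)
  case 0
  then show ?thesis
    using assms[of 1]
    by (simp add: cheb_U_def cheb_T_def q_binomial_def q_number_def cnst_def eta_def
        q_pochhammer_Suc numeral_2_eq_2 flip: one_pCons)
next
  case (Suc m)
  have "poly.coeff (cheb_T q (Suc (Suc m))) k
          = poly.coeff (cnst (q ^ Suc m) * var_x * cheb_T q (Suc m)
             + (var_x\<^sup>2 + cnst q * var_s) * eta q (eta q (cheb_U q (int m)))) k" for k
  proof (cases k)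
    case 0
    then show ?thesis
      by (simp add: coeff_cheb_U[OF assms] coeff_cheb_T[OF assms] T_coeff_Suc_Suc_0[OF assms]
          coeff_cnst_mult coeff_var_x_mult coeff_var_s_mult coeff_eta
          distrib_right mult.assoc power2_eq_square smult_monom mult_monom add_monom
          del: of_nat_Suc power_Suc)
  next
    case (Suc j)
    have T: "monom 1 1 * monom (T_coeff q (Suc m) k) (Suc m - 2 * k)
        = monom (T_coeff q (Suc m) k) (Suc (Suc m) - 2 * k)"
      by (cases "2 * k \<le> Suc m") (simp_all add: mult_monom Suc_diff_le T_coeff_def)
    have U: "monom 1 1 * (monom 1 1 * monom (U_coeff q m k) (m - 2 * k))
        = monom (U_coeff q m k) (Suc (Suc m) - 2 * k)"
      by (cases "2 * k \<le> m") (simp_all add: mult_monom Suc_diff_le U_coeff_def)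
    have eta: "q ^ k * (q ^ k * x) = q ^ (2 * k) * x" "q * (q ^ j * (q ^ j * x)) = q ^ (2 * j + 1) * x" for x
      by (simp_all add: mult_2 power_add)
    have "poly.coeff (cnst (q ^ Suc m) * var_x * cheb_T q (Suc m)
             + (var_x\<^sup>2 + cnst q * var_s) * eta q (eta q (cheb_U q (int m)))) k
        = smult (q ^ Suc m) (monom 1 1 * monom (T_coeff q (Suc m) k) (Suc m - 2 * k))
          + (smult (q ^ k) (smult (q ^ k) (monom 1 1 * (monom 1 1 * monom (U_coeff q m k) (m - 2 * k))))
             + smult q (smult (q ^ j) (smult (q ^ j) (monom (U_coeff q m j) (m - 2 * j)))))"
      by (simp add: coeff_cheb_U[OF assms] coeff_cheb_T[OF assms] coeff_cnst_mult coeff_var_x_mult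
          coeff_var_s_mult coeff_eta distrib_right mult.assoc power2_eq_square Suc
          del: of_nat_Suc power_Suc mult_Suc_right)
    also have "\<dots> = monom (T_coeff q (Suc (Suc m)) k) (Suc (Suc m) - 2 * k)"
      unfolding T U smult_monom eta
      by (simp add: Suc T_coeff_Suc_Suc_Suc[OF assms] add_monom add.assoc del: power_Suc)
    finally show ?thesis
      by (simp only: coeff_cheb_T[OF assms])
  qed
  then show ?thesis
    using Suc by (simp add: poly_eq_iff numeral_2_eq_2)
qed

section \<open>The recursion for an indeterminate q and its uniqueness\<close>

lemma q_indet_power_neq_1: "j > 0 \<Longrightarrow> (q_indet :: 'a::field poly fract) ^ j \<noteq> 1"
proof -
  assume "j > 0"
  have "(q_indet :: 'a poly fract) ^ j = Fract (monom 1 j) 1"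
    by (induction j) (simp_all add: q_indet_def One_fract_def monom_Suc one_pCons)
  moreover have "(monom 1 j :: 'a poly) \<noteq> 1"
    using \<open>j > 0\<close> by (metis degree_1 degree_monom_eq less_numeral_extra(3) zero_neq_one)
  ultimately show ?thesis
    by (simp add: One_fract_def eq_fract)
qed

theorem theorem5p3:
  fixes q :: "'a::field poly fract"
  assumes "q = q_indet"
  shows
    "(cheb_T q 0 = 1 \<and> cheb_U q (- 1) = 0 \<and>
      (\<forall>n::nat.
         cheb_T q (n + 1) = cnst (q ^ n) * var_x * cheb_T q n
           + (var_x\<^sup>2 + cnst q * var_s) * (eta q ^^ 2) (cheb_U q (int n - 1)) \<and>
         cheb_U q (int n) = cheb_T q n + cnst (q ^ n) * var_x * cheb_U q (int n - 1)))
     \<and>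
     (\<forall>(t :: nat \<Rightarrow> 'a poly fract poly poly) (u :: int \<Rightarrow> 'a poly fract poly poly).
        t 0 = 1 \<and> u (- 1) = 0 \<and>
        (\<forall>n::nat.
           t (n + 1) = cnst (q ^ n) * var_x * t n
             + (var_x\<^sup>2 + cnst q * var_s) * (eta q ^^ 2) (u (int n - 1)) \<and>
           u (int n) = t n + cnst (q ^ n) * var_x * u (int n - 1))
        \<longrightarrow> (\<forall>n. t n = cheb_T q n) \<and> (\<forall>m \<ge> - 1. u m = cheb_U q m))"
proof -
  have q: "q ^ j \<noteq> 1" if "j > 0" for j
    using assms q_indet_power_neq_1 that by blast
  have init: "cheb_T q 0 = 1" "cheb_U q (- 1) = 0"
    by (simp_all add: cheb_T_def cheb_U_def)
  have unique: "(\<forall>n. t n = cheb_T q n) \<and> (\<forall>m \<ge> - 1. u m = cheb_U q m)"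
    if t0: "t 0 = 1" and u0: "u (- 1) = 0"
      and t: "\<And>n. t (n + 1) = cnst (q ^ n) * var_x * t n
             + (var_x\<^sup>2 + cnst q * var_s) * (eta q ^^ 2) (u (int n - 1))"
      and u: "\<And>n. u (int n) = t n + cnst (q ^ n) * var_x * u (int n - 1)"
    for t :: "nat \<Rightarrow> 'a poly fract poly poly" and u
  proof -
    \<comment> \<open>The index of \<open>u\<close> lags by one, as in the vector on the right of the recursion.\<close>
    have *: "t n = cheb_T q n \<and> u (int n - 1) = cheb_U q (int n - 1)" for n
    proof (induction n)
      case 0
      show ?case
        using t0 u0 init by simp
    next
      case (Suc n)
      have "t (n + 1) = cheb_T q (n + 1)"
        using Suc.IH t[of n] cheb_T_rec[OF q, of n] by simp
      moreover have "u (int n) = cheb_U q (int n)"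
        using Suc.IH u[of n] cheb_U_rec[OF q, of n] by simp
      ultimately show ?case
        by simp
    qed
    moreover have "u m = cheb_U q m" if "m \<ge> - 1" for m
      using *[of "nat (m + 1)"] that by simp
    ultimately show ?thesis
      by blast
  qed
  show ?thesis
    using init cheb_T_rec[OF q] cheb_U_rec[OF q] unique by blast
qed

end
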